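(* Let $R$ be a unital ring with involution $*$ and let $a\in R$. The following assertions are equivalent: (i) $a$ is dual core invertible. (ii) There exists $x\in R$ such that $axa=a$, ${}^\circ x={}^\circ (a^* )$ and $x^\circ=a^\circ$. (iii) There exists $x\in R$ such that $axa=a$, $xax=x$, $(xa)^*=xa$, $a^2x=a$ and $x^2a=x$. (iv) There exist a self-adjoint idempotent $r\in R$ and an idempotent $q\in R$ such that $Rr=Ra$, $qR=aR$ and $Rq=Ra$. (v) $a$ is (von Neumann) regular and there exist a self-adjoint idempotent $r\in R$ and an idempotent $q\in R$ such that $a^\circ=r^\circ$, ${}^\circ a={}^\circ q$ and $a^\circ=q^\circ$. If these assertions hold, then the dual core inverse $a_{\mathrm{core}}$ of $a$ is unique, any $x$ as in (ii) or as in (iii) equals $a_{\mathrm{core}}$, the pair $(r,q)$ in (iv) is unique, the pair $(r,q)$ in (v) is unique, and these two pairs coincide. Moreover, in this case the element $ra^{(1)}q$ does not depend on the choice of $a^{(1)}\in a\{1\}$, and $$a=\begin{bmatrix} a & 0 \\ 0 & 0 \end{bmatrix}_{q\times r},\qquad a_{\mathrm{core}}=\begin{bmatrix} ra^{(1)}q & 0 \\ 0 & 0 \end{bmatrix}_{r\times q}.$$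
   Context: For $a\in R$: $aR=\{ax:x\in R\}$, $Ra=\{xa:x\in R\}$, $a^\circ=\{x\in R: ax=0\}$, ${}^\circ a=\{x\in R: xa=0\}$. The element $a$ is regular if there is $x\in R$ with $axa=a$; $a\{1\}$ is the set of all such $x$, and $a^{(1)}$ denotes an arbitrary element of $a\{1\}$. A self-adjoint idempotent is $p$ with $p^2=p=p^*$. An element $x\in R$ is a dual core inverse of $a$ (denoted $a_{\mathrm{core}}$) if $axa=a$, $xR=a^*R$ and $Rx=Ra$; $a$ is dual core invertible if it has a dual core inverse. For idempotents $s,t\in R$, the notation $x=\begin{bmatrix} x_{11} & x_{12} \\ x_{21} & x_{22} \end{bmatrix}_{s\times t}$ means $x_{11}=sxt$, $x_{12}=sx(1-t)$, $x_{21}=(1-s)xt$, $x_{22}=(1-s)x(1-t)$ (so $x$ is the sum of the four entries). *)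

theory Defs
  imports Main
begin

(* Sort {ring, monoid_mult} instead of ring_1, because ring_1 demands 0 \<noteq> 1
   and would exclude the zero ring. *)
class star_ring = ring + monoid_mult +
  fixes star :: "'a \<Rightarrow> 'a"  ("(_\<^sup>\<star>)" [1000] 999)
  assumes star_star: "(x\<^sup>\<star>)\<^sup>\<star> = x"
    and star_add: "(x + y)\<^sup>\<star> = x\<^sup>\<star> + y\<^sup>\<star>"
    and star_mult: "(x * y)\<^sup>\<star> = y\<^sup>\<star> * x\<^sup>\<star>"

definition right_ideal :: "'a::star_ring \<Rightarrow> 'a set" where
  "right_ideal a = {a * x | x. True}"

definition left_ideal :: "'a::star_ring \<Rightarrow> 'a set" where
  "left_ideal a = {x * a | x. True}"

definition rann :: "'a::star_ring \<Rightarrow> 'a set" where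
  "rann a = {x. a * x = 0}"

definition lann :: "'a::star_ring \<Rightarrow> 'a set" where
  "lann a = {x. x * a = 0}"

definition inner_inverses :: "'a::star_ring \<Rightarrow> 'a set" where
  "inner_inverses a = {x. a * x * a = a}"

definition regular :: "'a::star_ring \<Rightarrow> bool" where
  "regular a \<longleftrightarrow> (\<exists>x. a * x * a = a)"

definition idempotent :: "'a::star_ring \<Rightarrow> bool" where
  "idempotent p \<longleftrightarrow> p * p = p"

definition self_adjoint_idempotent :: "'a::star_ring \<Rightarrow> bool" where
  "self_adjoint_idempotent p \<longleftrightarrow> p * p = p \<and> p\<^sup>\<star> = p"

definition is_dual_core_inverse :: "'a::star_ring \<Rightarrow> 'a \<Rightarrow> bool" where
  "is_dual_core_inverse a x \<longleftrightarrow>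
     a * x * a = a \<and> right_ideal x = right_ideal (a\<^sup>\<star>) \<and> left_ideal x = left_ideal a"

definition dual_core_invertible :: "'a::star_ring \<Rightarrow> bool" where
  "dual_core_invertible a \<longleftrightarrow> (\<exists>x. is_dual_core_inverse a x)"

(* Unspecified unless a has exactly one dual core inverse. *)
definition dual_core :: "'a::star_ring \<Rightarrow> 'a" where
  "dual_core a = (THE x. is_dual_core_inverse a x)"

definition annihilator_inverse :: "'a::star_ring \<Rightarrow> 'a \<Rightarrow> bool" where
  "annihilator_inverse a x \<longleftrightarrow>
     a * x * a = a \<and> lann x = lann (a\<^sup>\<star>) \<and> rann x = rann a"

definition equational_inverse :: "'a::star_ring \<Rightarrow> 'a \<Rightarrow> bool" where
  "equational_inverse a x \<longleftrightarrow>
     a * x * a = a \<and> x * a * x = x \<and> (x * a)\<^sup>\<star> = x * a \<and> a\<^sup>2 * x = a \<and> x\<^sup>2 * a = x"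

definition ideal_pair :: "'a::star_ring \<Rightarrow> 'a \<Rightarrow> 'a \<Rightarrow> bool" where
  "ideal_pair a r q \<longleftrightarrow>
     self_adjoint_idempotent r \<and> idempotent q \<and>
     left_ideal r = left_ideal a \<and> right_ideal q = right_ideal a \<and> left_ideal q = left_ideal a"

definition annihilator_pair :: "'a::star_ring \<Rightarrow> 'a \<Rightarrow> 'a \<Rightarrow> bool" where
  "annihilator_pair a r q \<longleftrightarrow>
     self_adjoint_idempotent r \<and> idempotent q \<and>
     rann a = rann r \<and> lann a = lann q \<and> rann a = rann q"

(* x = [x11, x12; x21, x22] with respect to s \<times> t; meant for idempotents s and t. *)
definition has_matrix :: "'a::star_ring \<Rightarrow> 'a \<Rightarrow> 'a \<Rightarrow> 'a \<Rightarrow> 'a \<Rightarrow> 'a \<Rightarrow> 'a \<Rightarrow> bool" where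
  "has_matrix s t x x11 x12 x21 x22 \<longleftrightarrow>
     x11 = s * x * t \<and> x12 = s * x * (1 - t) \<and>
     x21 = (1 - s) * x * t \<and> x22 = (1 - s) * x * (1 - t)"

end

theory Submission
  imports Defs
begin

text \<open>
  A dual core inverse \<open>x\<close> is the same as a solution of the equations in (iii), and is encoded by the
  pair of idempotents \<open>r = xa\<close> and \<open>q = ax\<close>; since \<open>x = xax\<close>, the pair determines \<open>x\<close>. The pair itself is
  determined by \<open>Rr = Ra\<close>, \<open>qR = aR\<close> and \<open>Rq = Ra\<close>, and conversely any such pair produces the dual core
  inverse \<open>ra\<^sup>(\<^sup>1\<^sup>)q\<close>. Ideal conditions and annihilator conditions are interchangeable between regular
  elements, because \<open>bzb = b\<close> means \<open>1 - zb \<in> b\<^sup>\<circ>\<close> and \<open>1 - bz \<in> \<^sup>\<circ>b\<close>.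
\<close>

section \<open>Principal ideals and annihilators\<close>

lemma self_mem_left_ideal: "b \<in> left_ideal (b::'a::star_ring)"
  unfolding left_ideal_def by (auto intro: exI[of _ 1])

lemma self_mem_right_ideal: "b \<in> right_ideal (b::'a::star_ring)"
  unfolding right_ideal_def by (auto intro: exI[of _ 1])

text \<open>Because the ring has a unit, each ideal contains its generator, so an equality of ideals
  can be traded for two factorizations.\<close>

lemma left_ideal_eq_iff:
  fixes b c :: "'a::star_ring"
  shows "left_ideal b = left_ideal c \<longleftrightarrow> (\<exists>u. b = u * c) \<and> (\<exists>v. c = v * b)"
proof
  assume "left_ideal b = left_ideal c"
  then have "b \<in> left_ideal c" "c \<in> left_ideal b"
    using self_mem_left_ideal by auto
  then show "(\<exists>u. b = u * c) \<and> (\<exists>v. c = v * b)"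
    by (simp add: left_ideal_def)
next
  assume "(\<exists>u. b = u * c) \<and> (\<exists>v. c = v * b)"
  then obtain u v where "b = u * c" "c = v * b" by blast
  then show "left_ideal b = left_ideal c"
    unfolding left_ideal_def by (safe; metis mult.assoc)
qed

lemma right_ideal_eq_iff:
  fixes b c :: "'a::star_ring"
  shows "right_ideal b = right_ideal c \<longleftrightarrow> (\<exists>u. b = c * u) \<and> (\<exists>v. c = b * v)"
proof
  assume "right_ideal b = right_ideal c"
  then have "b \<in> right_ideal c" "c \<in> right_ideal b"
    using self_mem_right_ideal by auto
  then show "(\<exists>u. b = c * u) \<and> (\<exists>v. c = b * v)"
    by (simp add: right_ideal_def)
next
  assume "(\<exists>u. b = c * u) \<and> (\<exists>v. c = b * v)"
  then obtain u v where "b = c * u" "c = b * v" by blast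
  then show "right_ideal b = right_ideal c"
    unfolding right_ideal_def by (safe; metis mult.assoc)
qed

lemma rann_eq_if_left_ideal_eq:
  fixes b c :: "'a::star_ring"
  assumes "left_ideal b = left_ideal c"
  shows "rann b = rann c"
proof -
  obtain u v where "b = u * c" "c = v * b"
    using assms unfolding left_ideal_eq_iff by blast
  then show ?thesis
    unfolding rann_def by (safe; metis mult.assoc mult_zero_right)
qed

lemma lann_eq_if_right_ideal_eq:
  fixes b c :: "'a::star_ring"
  assumes "right_ideal b = right_ideal c"
  shows "lann b = lann c"
proof -
  obtain u v where "b = c * u" "c = b * v"
    using assms unfolding right_ideal_eq_iff by blast
  then show ?thesis
    unfolding lann_def by (safe; metis mult.assoc mult_zero_left)
qed

text \<open>Turns an inclusion of annihilators into a factorization with explicit left factor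
  \<open>c * z\<close>. Only \<open>b\<close> comes with an inner inverse, so \<open>c\<close> may
  be an element whose regularity is still open.\<close>

lemma rann_subset_inner_inverse:
  fixes b c z :: "'a::star_ring"
  assumes "rann b \<subseteq> rann c" and "b * z * b = b"
  shows "c * z * b = c"
proof -
  have "1 - z * b \<in> rann b"
    using assms(2) by (simp add: rann_def right_diff_distrib mult.assoc)
  with assms(1) have "1 - z * b \<in> rann c" by blast
  then show ?thesis by (simp add: rann_def right_diff_distrib mult.assoc)
qed

lemma lann_subset_inner_inverse:
  fixes b c z :: "'a::star_ring"
  assumes "lann b \<subseteq> lann c" and "b * z * b = b"
  shows "b * z * c = c"
proof -
  have "1 - b * z \<in> lann b"
    using assms(2) by (simp add: lann_def left_diff_distrib mult.assoc)
  with assms(1) have "1 - b * z \<in> lann c" by blast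
  then show ?thesis by (simp add: lann_def left_diff_distrib mult.assoc)
qed

lemma regular_left_ideal_eq_iff_rann_eq:
  fixes b c :: "'a::star_ring"
  assumes "regular b" and "regular c"
  shows "left_ideal b = left_ideal c \<longleftrightarrow> rann b = rann c"
proof
  assume "rann b = rann c"
  then show "left_ideal b = left_ideal c"
    using assms rann_subset_inner_inverse[of b c] rann_subset_inner_inverse[of c b]
    unfolding regular_def left_ideal_eq_iff by (metis order_refl)
qed (rule rann_eq_if_left_ideal_eq)

lemma regular_right_ideal_eq_iff_lann_eq:
  fixes b c :: "'a::star_ring"
  assumes "regular b" and "regular c"
  shows "right_ideal b = right_ideal c \<longleftrightarrow> lann b = lann c"
proof
  assume "lann b = lann c"
  then show "right_ideal b = right_ideal c"
    using assms lann_subset_inner_inverse[of b c] lann_subset_inner_inverse[of c b]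
    unfolding regular_def right_ideal_eq_iff by (metis order_refl mult.assoc)
qed (rule lann_eq_if_right_ideal_eq)

section \<open>Idempotents determined by their ideals\<close>

lemma idempotent_regular: "idempotent p \<Longrightarrow> regular (p::'a::star_ring)"
  unfolding idempotent_def regular_def by metis

lemma self_adjoint_idempotent_idempotent:
  "self_adjoint_idempotent p \<Longrightarrow> idempotent (p::'a::star_ring)"
  unfolding self_adjoint_idempotent_def idempotent_def by blast

text \<open>An idempotent is a right identity on its left ideal: \<open>b = u * p\<close> gives
  \<open>b * p = u * p * p = b\<close>.\<close>

lemma mult_idempotent_of_left_ideal_eq:
  fixes b p :: "'a::star_ring"
  assumes "left_ideal b = left_ideal p" and "idempotent p"
  shows "b * p = b"
  using assms unfolding left_ideal_eq_iff idempotent_def by (metis mult.assoc)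

lemma idempotent_mult_of_right_ideal_eq:
  fixes b p :: "'a::star_ring"
  assumes "right_ideal b = right_ideal p" and "idempotent p"
  shows "p * b = b"
  using assms unfolding right_ideal_eq_iff idempotent_def by (metis mult.assoc)

text \<open>The product \<open>p * q\<close> equals \<open>p\<close> by the left ideals and
  \<open>q\<close> by the right ideals.\<close>

lemma idempotent_eqI:
  fixes p q :: "'a::star_ring"
  assumes "idempotent p" "idempotent q"
    and "left_ideal p = left_ideal q" "right_ideal p = right_ideal q"
  shows "p = q"
  using mult_idempotent_of_left_ideal_eq[OF assms(3,2)]
    idempotent_mult_of_right_ideal_eq[OF assms(4)[symmetric] assms(1)] by simp

text \<open>The involution replaces the condition on right ideals: it turns \<open>r * s = r\<close>
  into \<open>s * r = r\<close>, while the left ideals also give \<open>s * r = s\<close>.\<close>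

lemma self_adjoint_idempotent_eqI:
  fixes r s :: "'a::star_ring"
  assumes "self_adjoint_idempotent r" "self_adjoint_idempotent s"
    and "left_ideal r = left_ideal s"
  shows "r = s"
proof -
  have "r * s = r" "s * r = s"
    using assms mult_idempotent_of_left_ideal_eq self_adjoint_idempotent_idempotent by metis+
  then show ?thesis
    using assms(1,2) star_mult[of r s] unfolding self_adjoint_idempotent_def by simp
qed

section \<open>Dual core inverses by ideals, equations and annihilators\<close>

text \<open>With \<open>e = x * a\<close> the hypothesis reads
  \<open>e\<^sup>\<star> * x = x\<close>. Multiplying by \<open>a\<close> gives
  \<open>e\<^sup>\<star> * e = e\<close>, so \<open>e\<close> is self-adjoint, and the hypothesis
  becomes \<open>e * x = x\<close>.\<close>

lemma star_projection_of_absorb: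
  fixes a x :: "'a::star_ring"
  assumes "a\<^sup>\<star> * x\<^sup>\<star> * x = x"
  shows "(x * a)\<^sup>\<star> = x * a" and "x * a * x = x"
proof -
  have "(x * a)\<^sup>\<star> * (x * a) = x * a"
    using assms star_mult by (metis mult.assoc)
  then show sa: "(x * a)\<^sup>\<star> = x * a"
    by (metis star_mult star_star)
  show "x * a * x = x"
    using assms sa star_mult by metis
qed

lemma is_dual_core_inverse_iff_equational_inverse:
  fixes a x :: "'a::star_ring"
  shows "is_dual_core_inverse a x \<longleftrightarrow> equational_inverse a x"
proof
  assume "is_dual_core_inverse a x"
  then have axa: "a * x * a = a"
    and right: "right_ideal x = right_ideal (a\<^sup>\<star>)"
    and left: "left_ideal x = left_ideal a"
    unfolding is_dual_core_inverse_def by auto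
  obtain u v where u: "x = u * a" and v: "a = v * x"
    using left unfolding left_ideal_eq_iff by blast
  obtain w where w: "x = a\<^sup>\<star> * w"
    using right unfolding right_ideal_eq_iff by blast
  \<comment> \<open>Applying the involution to \<open>axa\<close> shows that
    \<open>a\<^sup>\<star> * x\<^sup>\<star>\<close> fixes \<open>a\<^sup>\<star>\<close> from the
    left, hence also \<open>x = a\<^sup>\<star> * w\<close>.\<close>
  have "a\<^sup>\<star> * x\<^sup>\<star> * a\<^sup>\<star> = a\<^sup>\<star>"
    using axa star_mult by (metis mult.assoc)
  then have x: "a\<^sup>\<star> * x\<^sup>\<star> * x = x"
    using w by (metis mult.assoc)
  have sa: "(x * a)\<^sup>\<star> = x * a" and xax: "x * a * x = x"
    using star_projection_of_absorb[OF x] by auto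
  \<comment> \<open>Left multiplication by \<open>v\<close> changes the leading \<open>x\<close> of
    \<open>xax\<close> into \<open>a\<close>; below, \<open>u\<close> does the same for
    \<open>axa\<close>.\<close>
  have "v * x * a * x = v * (x * a * x)"
    by (simp add: mult.assoc)
  then have aax: "a * a * x = a"
    using v xax by simp
  have "u * a * x * a = u * (a * x * a)"
    by (simp add: mult.assoc)
  then have xxa: "x * x * a = x"
    using u axa by simp
  then show "equational_inverse a x"
    using axa xax sa aax xxa unfolding equational_inverse_def power2_eq_square by simp
next
  assume "equational_inverse a x"
  then have axa: "a * x * a = a" and xax: "x * a * x = x" and sa: "(x * a)\<^sup>\<star> = x * a"
    and aax: "a * a * x = a" and xxa: "x * x * a = x"
    unfolding equational_inverse_def power2_eq_square by auto
  have "x = a\<^sup>\<star> * (x\<^sup>\<star> * x)"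
    using xax sa star_mult by (metis mult.assoc)
  moreover have "a\<^sup>\<star> = x * (a * a\<^sup>\<star>)"
    using axa sa star_mult by (metis mult.assoc)
  ultimately have "right_ideal x = right_ideal (a\<^sup>\<star>)"
    unfolding right_ideal_eq_iff by blast
  moreover have "left_ideal x = left_ideal a"
    unfolding left_ideal_eq_iff using aax xxa by metis
  ultimately show "is_dual_core_inverse a x"
    using axa unfolding is_dual_core_inverse_def by simp
qed

text \<open>For the converse, the annihilators are exploited first through \<open>a\<close> and
  \<open>a\<^sup>\<star>\<close>, whose inner inverses \<open>x\<close> and
  \<open>x\<^sup>\<star>\<close> are known. This yields \<open>x * a * x = x\<close>, after which
  \<open>a\<close> serves as an inner inverse of \<open>x\<close>.\<close>

lemma is_dual_core_inverse_iff_annihilator_inverse: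
  fixes a x :: "'a::star_ring"
  shows "is_dual_core_inverse a x \<longleftrightarrow> annihilator_inverse a x"
proof
  assume "is_dual_core_inverse a x"
  then show "annihilator_inverse a x"
    unfolding is_dual_core_inverse_def annihilator_inverse_def
    using lann_eq_if_right_ideal_eq rann_eq_if_left_ideal_eq by blast
next
  assume "annihilator_inverse a x"
  then have axa: "a * x * a = a" and lann: "lann x = lann (a\<^sup>\<star>)" and rann: "rann x = rann a"
    unfolding annihilator_inverse_def by auto
  have xxa: "x * x * a = x"
    using rann_subset_inner_inverse[of a x x] rann axa by simp
  have "a\<^sup>\<star> * x\<^sup>\<star> * a\<^sup>\<star> = a\<^sup>\<star>"
    using axa star_mult by (metis mult.assoc)
  then have x: "a\<^sup>\<star> * x\<^sup>\<star> * x = x"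
    using lann_subset_inner_inverse[of "a\<^sup>\<star>" x "x\<^sup>\<star>"] lann by simp
  have sa: "(x * a)\<^sup>\<star> = x * a" and xax: "x * a * x = x"
    using star_projection_of_absorb[OF x] by auto
  have "a * a * x = a"
    using rann_subset_inner_inverse[of x a a] rann xax by simp
  then show "is_dual_core_inverse a x"
    unfolding is_dual_core_inverse_iff_equational_inverse
    using axa xax sa xxa unfolding equational_inverse_def power2_eq_square by simp
qed

section \<open>Pairs of idempotents\<close>

lemma equational_inverse_ideal_pair:
  fixes a x :: "'a::star_ring"
  assumes "equational_inverse a x"
  shows "ideal_pair a (x * a) (a * x)"
proof -
  have axa: "a * x * a = a" and xax: "x * a * x = x" and sa: "(x * a)\<^sup>\<star> = x * a"
    and aax: "a * a * x = a" and xxa: "x * x * a = x"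
    using assms unfolding equational_inverse_def power2_eq_square by auto
  have "self_adjoint_idempotent (x * a)" "idempotent (a * x)"
    using axa sa unfolding self_adjoint_idempotent_def idempotent_def by (metis mult.assoc)+
  moreover have "left_ideal (x * a) = left_ideal a"
    unfolding left_ideal_eq_iff using axa by (metis mult.assoc)
  moreover have "right_ideal (a * x) = right_ideal a"
    unfolding right_ideal_eq_iff using axa by metis
  \<comment> \<open>The factorizations are \<open>a * x = (a * x * x) * a\<close> and
    \<open>a = a * (a * x)\<close>.\<close>
  moreover have "left_ideal (a * x) = left_ideal a"
    unfolding left_ideal_eq_iff using aax xxa by (metis mult.assoc)
  ultimately show ?thesis unfolding ideal_pair_def by blast
qed

lemma ideal_pair_unique:
  fixes a r q r' q' :: "'a::star_ring"
  assumes "ideal_pair a r q" and "ideal_pair a r' q'"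
  shows "r = r'" and "q = q'"
  using assms self_adjoint_idempotent_eqI[of r r'] idempotent_eqI[of q q']
  unfolding ideal_pair_def by simp_all

text \<open>Equal idempotents force equal inverses:
  \<open>x = x * a * x = y * a * x = y * a * y = y\<close>.\<close>

lemma equational_inverse_unique:
  fixes a x y :: "'a::star_ring"
  assumes "equational_inverse a x" and "equational_inverse a y"
  shows "x = y"
proof -
  have "x * a = y * a" "a * x = a * y"
    using assms ideal_pair_unique equational_inverse_ideal_pair by blast+
  then show ?thesis
    using assms unfolding equational_inverse_def by (metis mult.assoc)
qed

lemma ideal_pair_absorb:
  fixes a r q :: "'a::star_ring"
  assumes "ideal_pair a r q"
  shows "a * r = a" and "q * a = a" and "a * q = a" and "q * r = q"
    and "r * r = r" and "q * q = q" and "r\<^sup>\<star> = r"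
proof -
  have r: "self_adjoint_idempotent r" and q: "idempotent q" and Rr: "left_ideal r = left_ideal a"
    and qR: "right_ideal q = right_ideal a" and Rq: "left_ideal q = left_ideal a"
    using assms unfolding ideal_pair_def by auto
  note r' = self_adjoint_idempotent_idempotent[OF r]
  show "a * r = a" "q * r = q"
    using mult_idempotent_of_left_ideal_eq[OF _ r'] Rr Rq by simp_all
  show "a * q = a" using mult_idempotent_of_left_ideal_eq[OF Rq[symmetric] q] .
  show "q * a = a" using idempotent_mult_of_right_ideal_eq[OF qR[symmetric] q] .
  show "r * r = r" "r\<^sup>\<star> = r" "q * q = q"
    using r q unfolding self_adjoint_idempotent_def idempotent_def by simp_all
qed

lemma ideal_pair_regular:
  fixes a r q :: "'a::star_ring"
  assumes "ideal_pair a r q"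
  shows "regular a"
proof -
  obtain z where "q = a * z"
    using assms unfolding ideal_pair_def right_ideal_eq_iff by blast
  then show ?thesis
    using ideal_pair_absorb(2)[OF assms] unfolding regular_def by blast
qed

text \<open>The candidate satisfies \<open>a * ?x = q\<close> and \<open>?x * a = r\<close>, which
  reduces all five equations to the absorption rules.\<close>

lemma ideal_pair_equational_inverse:
  fixes a r q y :: "'a::star_ring"
  assumes pair: "ideal_pair a r q" and aya: "a * y * a = a"
  shows "equational_inverse a (r * y * q)"
proof -
  note absorb = ideal_pair_absorb[OF pair]
  let ?x = "r * y * q"
  obtain u z where u: "r = u * a" and z: "q = a * z"
    using pair unfolding ideal_pair_def right_ideal_eq_iff left_ideal_eq_iff by blast
  have "a * ?x = a * y * q" using absorb(1) by (metis mult.assoc)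
  \<comment> \<open>Substituting \<open>q = a * z\<close> exposes the factor
    \<open>a * y * a\<close>; for the other product, \<open>r = u * a\<close> does the same.\<close>
  also have "\<dots> = q" using z aya by (metis mult.assoc)
  finally have ax: "a * ?x = q" .
  have "?x * a = r * y * a" using absorb(2) by (simp add: mult.assoc)
  also have "\<dots> = r" using u aya by (metis mult.assoc)
  finally have xa: "?x * a = r" .
  have "r * ?x = ?x" using absorb(5) by (metis mult.assoc)
  moreover have "?x * r = ?x" using absorb(4) by (simp add: mult.assoc)
  ultimately show ?thesis
    unfolding equational_inverse_def power2_eq_square
    using ax xa absorb by (simp add: mult.assoc)
qed

text \<open>Idempotents are regular, so with \<open>a\<close> regular each of the three ideal
  conditions translates separately.\<close>

lemma regular_ideal_pair_iff_annihilator_pair: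
  fixes a r q :: "'a::star_ring"
  assumes "regular a"
  shows "ideal_pair a r q \<longleftrightarrow> annihilator_pair a r q"
proof (cases "self_adjoint_idempotent r \<and> idempotent q")
  case True
  then have "regular r" "regular q"
    using idempotent_regular self_adjoint_idempotent_idempotent by blast+
  then have "left_ideal r = left_ideal a \<longleftrightarrow> rann r = rann a"
    "right_ideal q = right_ideal a \<longleftrightarrow> lann q = lann a"
    "left_ideal q = left_ideal a \<longleftrightarrow> rann q = rann a"
    using assms
    by (simp_all only: regular_left_ideal_eq_iff_rann_eq regular_right_ideal_eq_iff_lann_eq)
  then show ?thesis
    unfolding ideal_pair_def annihilator_pair_def by metis
next
  case False
  then show ?thesis
    unfolding ideal_pair_def annihilator_pair_def by blast
qed

section \<open>Matrix form and assembly of the equivalences\<close>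

text \<open>The hypotheses say that \<open>1 - s\<close> kills \<open>x\<close> from the left and
  \<open>1 - t\<close> from the right, which leaves only the first entry.\<close>

lemma has_matrix_corner:
  fixes s t x :: "'a::star_ring"
  assumes "s * x = x" and "x * t = x"
  shows "has_matrix s t x x 0 0 0"
  using assms unfolding has_matrix_def
  by (simp add: left_diff_distrib right_diff_distrib)

theorem theorem2p15:
  fixes a :: "'a::star_ring"
  shows
    "(dual_core_invertible a \<longleftrightarrow> (\<exists>x. annihilator_inverse a x)) \<and>
     (dual_core_invertible a \<longleftrightarrow> (\<exists>x. equational_inverse a x)) \<and>
     (dual_core_invertible a \<longleftrightarrow> (\<exists>r q. ideal_pair a r q)) \<and>
     (dual_core_invertible a \<longleftrightarrow> regular a \<and> (\<exists>r q. annihilator_pair a r q)) \<and>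
     (dual_core_invertible a \<longrightarrow>
        (\<exists>!x. is_dual_core_inverse a x) \<and>
        (\<forall>x. annihilator_inverse a x \<longrightarrow> x = dual_core a) \<and>
        (\<forall>x. equational_inverse a x \<longrightarrow> x = dual_core a) \<and>
        (\<exists>!p. case p of (r, q) \<Rightarrow> ideal_pair a r q) \<and>
        (\<exists>!p. case p of (r, q) \<Rightarrow> annihilator_pair a r q) \<and>
        (\<forall>r q. ideal_pair a r q \<longleftrightarrow> annihilator_pair a r q) \<and>
        (\<forall>r q. ideal_pair a r q \<longrightarrow>
           (\<forall>y\<in>inner_inverses a. \<forall>z\<in>inner_inverses a. r * y * q = r * z * q) \<and>
           has_matrix q r a a 0 0 0 \<and>
           (\<forall>y\<in>inner_inverses a. has_matrix r q (dual_core a) (r * y * q) 0 0 0)))"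
proof -
  have core_iff: "dual_core_invertible a \<longleftrightarrow> (\<exists>x. equational_inverse a x)"
    unfolding dual_core_invertible_def is_dual_core_inverse_iff_equational_inverse ..
  have ann_iff: "annihilator_inverse a x \<longleftrightarrow> equational_inverse a x" for x
    using is_dual_core_inverse_iff_annihilator_inverse
      is_dual_core_inverse_iff_equational_inverse by blast
  \<comment> \<open>A pair yields an inverse only through some inner inverse of \<open>a\<close>,
    which exists by \<open>ideal_pair_regular\<close>.\<close>
  have pair_iff: "dual_core_invertible a \<longleftrightarrow> (\<exists>r q. ideal_pair a r q)"
    unfolding core_iff
    using equational_inverse_ideal_pair ideal_pair_equational_inverse ideal_pair_regular
    unfolding regular_def by metis
  have regular: "regular a" if "dual_core_invertible a"
    using that pair_iff ideal_pair_regular by blast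
  have ann_pair_iff:
    "dual_core_invertible a \<longleftrightarrow> regular a \<and> (\<exists>r q. annihilator_pair a r q)"
    using pair_iff regular regular_ideal_pair_iff_annihilator_pair by blast
  have dual_core_eq: "x = dual_core a" if "equational_inverse a x" for x
    unfolding dual_core_def is_dual_core_inverse_iff_equational_inverse
    using that equational_inverse_unique by (blast intro: the_equality[symmetric])
  have unique: "\<exists>!x. is_dual_core_inverse a x" if "dual_core_invertible a"
    using that equational_inverse_unique
    unfolding core_iff is_dual_core_inverse_iff_equational_inverse by blast
  have pair_unique: "\<exists>!p. case p of (r, q) \<Rightarrow> ideal_pair a r q" if "dual_core_invertible a"
    using that ideal_pair_unique unfolding pair_iff by fast
  have pairs_agree: "ideal_pair a r q \<longleftrightarrow> annihilator_pair a r q"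
    if "dual_core_invertible a" for r q
    using regular_ideal_pair_iff_annihilator_pair[OF regular[OF that]] .
  have ann_pair_unique: "\<exists>!p. case p of (r, q) \<Rightarrow> annihilator_pair a r q"
    if "dual_core_invertible a"
    using pair_unique[OF that] unfolding pairs_agree[OF that] .
  \<comment> \<open>The right-hand side does not mention \<open>y\<close>, so this also settles
    independence of the chosen inner inverse.\<close>
  have core_formula: "r * y * q = dual_core a"
    if "ideal_pair a r q" "y \<in> inner_inverses a" for r q y
    using that dual_core_eq ideal_pair_equational_inverse unfolding inner_inverses_def by blast
  have matrix_a: "has_matrix q r a a 0 0 0" if "ideal_pair a r q" for r q
    using ideal_pair_absorb[OF that] has_matrix_corner by blast
  have matrix_core: "has_matrix r q (dual_core a) (r * y * q) 0 0 0"
    if pair: "ideal_pair a r q" and y: "y \<in> inner_inverses a" for r q y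
  proof -
    have "r * (r * y * q) = r * y * q" "r * y * q * q = r * y * q"
      using ideal_pair_absorb[OF pair] by (metis mult.assoc)+
    then show ?thesis
      using has_matrix_corner core_formula[OF pair y] by metis
  qed
  show ?thesis
    using core_iff pair_iff ann_pair_iff unique pair_unique ann_pair_unique pairs_agree
      ann_iff dual_core_eq core_formula matrix_a matrix_core
    by (intro conjI impI allI ballI) metis+
qed

end
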